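(* Let $\Gamma$ be a non-discrete, non-elementary subgroup of $\mathrm{PSL}_2(\mathbb{R})$. Then $\mathcal{E}(\Gamma)=\{h_0\}$, i.e. the only $\Gamma$-equivariant function is the identity map $h_0(z)=z$ of $\mathbb{H}$.
   Context: $\mathbb{H}$ is the upper half-plane and $\widehat{\mathbb{C}}=\mathbb{C}\cup\{\infty\}$. $\mathrm{PSL}_2(\mathbb{R})=\mathrm{SL}_2(\mathbb{R})/\{\pm I\}$, with its usual topology, acts on $\widehat{\mathbb{C}}$ by Möbius transformations, preserving $\mathbb{H}$ and $\mathbb{R}\cup\{\infty\}$. A subgroup of $\mathrm{PSL}_2(\mathbb{R})$ is elementary if it has a finite orbit in $\mathbb{H}\cup\mathbb{R}\cup\{\infty\}$. $\mathcal{E}(\Gamma)$ is the set of $\Gamma$-equivariant functions: meromorphic functions $h$ on $\mathbb{H}$ (viewed as maps $\mathbb{H}\to\widehat{\mathbb{C}}$) such that $h(\gamma z)=\gamma(h(z))$ for all $\gamma\in\Gamma$, $z\in\mathbb{H}$. *)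

theory Defs
  imports "HOL-Complex_Analysis.Complex_Analysis" "HOL-Algebra.Coset"
begin

definition SL2R :: "(real^2^2) monoid" where
  "SL2R = \<lparr>carrier = {A. det A = 1}, mult = (**), one = mat 1\<rparr>"

definition SL2R_center :: "(real^2^2) set" where
  "SL2R_center = {mat 1, - mat 1}"

text \<open>The elements of \<open>PSL2R\<close> are the cosets \<open>{A, - A}\<close>.\<close>

definition PSL2R :: "(real^2^2) set monoid" where
  "PSL2R = SL2R Mod SL2R_center"

text \<open>The quotient topology coming from \<open>SL2R\<close> as a subspace of \<open>real^2^2\<close>: the full
  preimage in \<open>SL2R\<close> of a set \<open>U\<close> of cosets is \<open>\<Union>U\<close>.\<close>

definition PSL2R_topology :: "(real^2^2) set topology" where
  "PSL2R_topology =
     topology (\<lambda>U. U \<subseteq> carrier PSL2R \<and> openin (top_of_set (carrier SL2R)) (\<Union>U))"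

definition discrete_PSL2R :: "(real^2^2) set set \<Rightarrow> bool" where
  "discrete_PSL2R \<Gamma> \<longleftrightarrow> subtopology PSL2R_topology \<Gamma> = discrete_topology \<Gamma>"

text \<open>The Riemann sphere, with \<open>None\<close> as the point at infinity.\<close>

type_synonym sphere = "complex option"

definition upper_half_plane :: "complex set" where
  "upper_half_plane = {z. Im z > 0}"

fun moebius_SL2R :: "real^2^2 \<Rightarrow> sphere \<Rightarrow> sphere" where
  "moebius_SL2R A (Some z) =
     (if of_real (A$2$1) * z + of_real (A$2$2) = 0 then None
      else Some (moebius (of_real (A$1$1)) (of_real (A$1$2))
                         (of_real (A$2$1)) (of_real (A$2$2)) z))"
| "moebius_SL2R A None =
     (if A$2$1 = 0 then None else Some (of_real (A$1$1) / of_real (A$2$1)))"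

text \<open>The common value of both representatives of the coset; see
  \<open>moebius_PSL2R_coset\<close> below.\<close>

definition moebius_PSL2R :: "(real^2^2) set \<Rightarrow> sphere \<Rightarrow> sphere" where
  "moebius_PSL2R \<gamma> w = the_elem ((\<lambda>A. moebius_SL2R A w) ` \<gamma>)"

definition elementary :: "(real^2^2) set set \<Rightarrow> bool" where
  "elementary \<Gamma> \<longleftrightarrow>
     (\<exists>w \<in> Some ` upper_half_plane \<union> Some ` range of_real \<union> {None}.
        finite ((\<lambda>\<gamma>. moebius_PSL2R \<gamma> w) ` \<Gamma>))"

text \<open>Meromorphic functions on the upper half-plane as maps to the sphere. A nicely meromorphic
  \<open>f\<close> has no removable singularities; its value 0 at the poles is a dummy and is replaced by
  infinity. Maps on the upper half-plane are \<^const>\<open>undefined\<close> outside of it, so that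
  equality of maps is equality on the upper half-plane. The constant map infinity is not
  meromorphic.\<close>

definition meromorphic_maps :: "(complex \<Rightarrow> sphere) set" where
  "meromorphic_maps =
     {\<lambda>z\<in>upper_half_plane. if is_pole f z then None else Some (f z) |f.
        f nicely_meromorphic_on upper_half_plane}"

text \<open>The function \<open>the\<close> is harmless here: \<open>\<gamma> z\<close> is a point of the upper half-plane;
  see \<open>moebius_PSL2R_upper_half_plane\<close> below.\<close>

definition equivariant_functions :: "(real^2^2) set set \<Rightarrow> (complex \<Rightarrow> sphere) set" where
  "equivariant_functions \<Gamma> =
     {h \<in> meromorphic_maps. \<forall>\<gamma>\<in>\<Gamma>. \<forall>z\<in>upper_half_plane.
        h (the (moebius_PSL2R \<gamma> (Some z))) = moebius_PSL2R \<gamma> (h z)}"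

lemma group_SL2R: "group SL2R"
proof (rule groupI)
  fix A assume "A \<in> carrier SL2R"
  then have d: "det A = 1" by (simp add: SL2R_def)
  then have "invertible A" by (simp add: invertible_det_nz)
  then obtain B where i: "B ** A = mat 1"
    by (auto simp: invertible_def)
  have "det B = 1"
    using arg_cong[OF i, of det] d by (simp add: det_mul)
  with i show "\<exists>B\<in>carrier SL2R. B \<otimes>\<^bsub>SL2R\<^esub> A = \<one>\<^bsub>SL2R\<^esub>"
    by (auto simp: SL2R_def)
qed (auto simp: SL2R_def det_mul matrix_mul_assoc)

lemma uminus_matrix_mul:
  fixes A B :: "real^2^2"
  shows "(- A) ** B = - (A ** B)" "A ** (- B) = - (A ** B)"
  by (simp_all add: vec_eq_iff matrix_matrix_mult_def sum_negf)

lemma det_uminus_2: "det (- A) = det (A :: real^2^2)"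
  by (simp add: det_2)

lemma SL2R_center_r_coset: "SL2R_center #>\<^bsub>SL2R\<^esub> A = {A, - A}"
  by (auto simp: SL2R_center_def r_coset_def SL2R_def uminus_matrix_mul)

lemma normal_SL2R_center: "SL2R_center \<lhd> SL2R"
proof -
  interpret group SL2R by (rule group_SL2R)
  have inv: "inv\<^bsub>SL2R\<^esub> (- mat 1) = - mat 1"
    by (rule inv_equality) (auto simp: SL2R_def uminus_matrix_mul det_uminus_2)
  have inv1: "inv\<^bsub>SL2R\<^esub> (mat 1) = mat 1"
    by (rule inv_equality) (auto simp: SL2R_def)
  have "subgroup SL2R_center SL2R"
  proof (rule subgroupI)
    show "SL2R_center \<subseteq> carrier SL2R" "SL2R_center \<noteq> {}"
      by (auto simp: SL2R_center_def SL2R_def det_uminus_2)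
  next
    fix A assume "A \<in> SL2R_center"
    then show "inv\<^bsub>SL2R\<^esub> A \<in> SL2R_center"
      by (auto simp: SL2R_center_def inv inv1)
  next
    fix A B assume "A \<in> SL2R_center" "B \<in> SL2R_center"
    then show "A \<otimes>\<^bsub>SL2R\<^esub> B \<in> SL2R_center"
      by (auto simp: SL2R_center_def SL2R_def uminus_matrix_mul)
  qed
  then show ?thesis
    by (rule normalI)
      (auto simp: SL2R_center_def r_coset_def l_coset_def SL2R_def uminus_matrix_mul)
qed

lemma group_PSL2R: "group PSL2R"
  unfolding PSL2R_def by (rule normal.factorgroup_is_group[OF normal_SL2R_center])

lemma carrier_PSL2R: "carrier PSL2R = (\<lambda>A. {A, - A}) ` carrier SL2R"
  by (auto simp: PSL2R_def FactGroup_def RCOSETS_def SL2R_center_r_coset)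

lemma openin_PSL2R_topology:
  "openin PSL2R_topology U \<longleftrightarrow>
     U \<subseteq> carrier PSL2R \<and> openin (top_of_set (carrier SL2R)) (\<Union>U)"
proof -
  have eq: "\<Union>(S \<inter> T) = \<Union>S \<inter> \<Union>T"
    if "S \<subseteq> carrier PSL2R" "T \<subseteq> carrier PSL2R" for S T
  proof
    show "\<Union>S \<inter> \<Union>T \<subseteq> \<Union>(S \<inter> T)"
    proof
      fix A assume "A \<in> \<Union>S \<inter> \<Union>T"
      then obtain s t where st: "s \<in> S" "t \<in> T" "A \<in> s" "A \<in> t" by blast
      with that have "s = {A, - A}" "t = {A, - A}"
        by (auto simp: carrier_PSL2R)
      with st show "A \<in> \<Union>(S \<inter> T)" by auto
    qed
  qed blast
  have "istopology (\<lambda>U. U \<subseteq> carrier PSL2R \<and> openin (top_of_set (carrier SL2R)) (\<Union>U))"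
    unfolding istopology_def
  proof (intro conjI allI impI)
    fix S T
    assume "S \<subseteq> carrier PSL2R \<and> openin (top_of_set (carrier SL2R)) (\<Union>S)"
      "T \<subseteq> carrier PSL2R \<and> openin (top_of_set (carrier SL2R)) (\<Union>T)"
    then show "S \<inter> T \<subseteq> carrier PSL2R" "openin (top_of_set (carrier SL2R)) (\<Union>(S \<inter> T))"
      by (auto simp only: eq intro!: openin_Int)
  next
    fix K
    assume *: "\<forall>U\<in>K. U \<subseteq> carrier PSL2R \<and> openin (top_of_set (carrier SL2R)) (\<Union>U)"
    then show "\<Union>K \<subseteq> carrier PSL2R" by blast
    have "\<Union>(\<Union>K) = (\<Union>U\<in>K. \<Union>U)" by blast
    then show "openin (top_of_set (carrier SL2R)) (\<Union>(\<Union>K))"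
      using * by (simp only:) (rule openin_Union, blast)
  qed
  then show ?thesis
    by (simp add: PSL2R_topology_def topology_inverse')
qed

lemma Union_carrier_PSL2R: "\<Union>(carrier PSL2R) = carrier SL2R"
  by (auto simp: carrier_PSL2R SL2R_def det_uminus_2)

lemma topspace_PSL2R_topology: "topspace PSL2R_topology = carrier PSL2R"
proof
  show "topspace PSL2R_topology \<subseteq> carrier PSL2R"
    by (auto simp: topspace_def openin_PSL2R_topology)
  have "openin PSL2R_topology (carrier PSL2R)"
    by (simp add: openin_PSL2R_topology Union_carrier_PSL2R)
  then show "carrier PSL2R \<subseteq> topspace PSL2R_topology"
    by (rule openin_subset)
qed

lemma quotient_map_PSL2R:
  "quotient_map (top_of_set (carrier SL2R)) PSL2R_topology (\<lambda>A. SL2R_center #>\<^bsub>SL2R\<^esub> A)"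
proof -
  have "{A \<in> carrier SL2R. {A, - A} \<in> U} = \<Union>U" if "U \<subseteq> carrier PSL2R" for U
  proof
    show "\<Union>U \<subseteq> {A \<in> carrier SL2R. {A, - A} \<in> U}"
    proof
      fix A assume "A \<in> \<Union>U"
      then obtain u where u: "u \<in> U" "A \<in> u" by blast
      with that have "u = {A, - A}" by (auto simp: carrier_PSL2R)
      moreover have "A \<in> carrier SL2R"
        using u that Union_carrier_PSL2R by blast
      ultimately show "A \<in> {A \<in> carrier SL2R. {A, - A} \<in> U}"
        using u by simp
    qed
  qed auto
  then show ?thesis
    by (auto simp: quotient_map_def topspace_PSL2R_topology carrier_PSL2R
        SL2R_center_r_coset openin_PSL2R_topology)
qed

lemma moebius_SL2R_uminus: "moebius_SL2R (- A) w = moebius_SL2R A w"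
proof (cases w)
  case (Some z)
  have 1: "- (of_real (A$2$1) * z) - of_real (A$2$2)
      = - (of_real (A$2$1) * z + of_real (A$2$2))"
    "- (of_real (A$1$1) * z) - of_real (A$1$2)
      = - (of_real (A$1$1) * z + of_real (A$1$2))"
    by simp_all
  show ?thesis
    by (simp add: Some moebius_def 1 del: minus_add_distrib)
qed simp

lemma moebius_PSL2R_coset: "moebius_PSL2R (SL2R_center #>\<^bsub>SL2R\<^esub> A) w = moebius_SL2R A w"
  by (simp add: moebius_PSL2R_def SL2R_center_r_coset moebius_SL2R_uminus)

lemma moebius_PSL2R_upper_half_plane:
  assumes "\<gamma> \<in> carrier PSL2R" "z \<in> upper_half_plane"
  shows "moebius_PSL2R \<gamma> (Some z) \<in> Some ` upper_half_plane"
proof -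
  obtain A where A: "det A = 1" "\<gamma> = SL2R_center #>\<^bsub>SL2R\<^esub> A"
  proof -
    from assms(1) obtain A where "A \<in> carrier SL2R" "\<gamma> = {A, - A}"
      by (auto simp: carrier_PSL2R)
    then show ?thesis
      by (intro that[of A]) (simp_all add: SL2R_center_r_coset, simp add: SL2R_def)
  qed
  define a b c d where "a = A$1$1" and "b = A$1$2" and "c = A$2$1" and "d = A$2$2"
  have det: "a * d - b * c = 1"
    using A(1) by (simp add: det_2 a_def b_def c_def d_def)
  have z: "Im z > 0" using assms(2) by (simp add: upper_half_plane_def)
  have nz: "of_real c * z + of_real d \<noteq> 0"
  proof
    assume 0: "of_real c * z + of_real d = 0"
    from arg_cong[OF 0, of Im] z have "c = 0" by simp
    with arg_cong[OF 0, of Re] det show False by simp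
  qed
  let ?q = "(Re (of_real c * z + of_real d))\<^sup>2 + (Im (of_real c * z + of_real d))\<^sup>2"
  have q: "?q > 0"
    using nz by (metis complex_eq_iff sum_power2_gt_zero_iff zero_complex.sel)
  have "Im (moebius (of_real a) (of_real b) (of_real c) (of_real d) z)
      = (a * d - b * c) * Im z / ?q"
    by (simp add: moebius_def Im_divide algebra_simps)
  then have "moebius (of_real a) (of_real b) (of_real c) (of_real d) z \<in> upper_half_plane"
    using z q by (simp add: det upper_half_plane_def)
  then show ?thesis
    using nz by (simp add: A(2) moebius_PSL2R_coset a_def b_def c_def d_def)
qed

end

theory Submission
  imports Defs
begin

text \<open>Let \<open>A\<^sub>n \<rightarrow> 1\<close> be nontrivial elements of the group and let \<open>B\<close> be a limit of rescalings of
  \<open>A\<^sub>n - 1\<close>. Differentiating \<open>h (A\<^sub>n z) = A\<^sub>n (h z)\<close> gives \<open>h'(z) v\<^sub>B(z) = v\<^sub>B(h z)\<close>, where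
  \<open>v\<^sub>B\<close> is the vector field of \<open>B\<close>. The set of such \<open>B\<close> is closed under conjugation by the group. If it
  spans all trace-free matrices, the fields \<open>1\<close> and \<open>z\<close> give \<open>h' = 1\<close> and \<open>h z = z\<close>. Otherwise it spans
  an invariant line or plane, so the group fixes a trace-free matrix up to scaling and permutes
  the at most two zeros of its vector field, one of which lies in the closed half-plane; hence the
  group is elementary.\<close>

no_notation fps_nth (infixl "$" 75)

section \<open>Limit directions at the identity\<close>

lemma tendsto_matrix_mult:
  fixes A :: "real^'m^'n" and B :: "real^'k^'m"
  assumes "(f \<longlongrightarrow> A) F" "(g \<longlongrightarrow> B) F"
  shows "((\<lambda>x. f x ** g x) \<longlongrightarrow> A ** B) F"
  unfolding matrix_matrix_mult_def
  by (intro tendsto_vec_lambda tendsto_sum tendsto_mult tendsto_vec_nth assms)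

lemmas matrix_2_simps = vec_eq_iff matrix_matrix_mult_def sum_2 forall_2 mat_def

text \<open>This is the tangent cone of \<open>S\<close> at the identity together with its negative,
  since \<open>t n\<close> may have either sign. It need not be a linear subspace, so later
  arguments use linear relations that hold on all of it instead of its span.\<close>

definition limit_directions :: "(real^2^2) set \<Rightarrow> (real^2^2) set" where
  "limit_directions S = {B. \<exists>A t. (\<forall>n. A n \<in> S) \<and> A \<longlonglongrightarrow> mat 1 \<and>
     (\<lambda>n. t n *\<^sub>R (A n - mat 1)) \<longlonglongrightarrow> B}"

text \<open>Conjugation is linear, continuous and fixes the identity, so the sequence
  \<open>G ** A n ** G'\<close> with the same factors \<open>t n\<close> has the conjugated
  limit.\<close>

lemma limit_directions_conjugate:
  assumes S: "\<And>A B. A \<in> S \<Longrightarrow> B \<in> S \<Longrightarrow> A ** B \<in> S"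
    and G: "G \<in> S" "G' \<in> S" "G ** G' = mat 1"
    and B: "B \<in> limit_directions S"
  shows "G ** B ** G' \<in> limit_directions S"
proof -
  obtain A t where A: "\<And>n. A n \<in> S" "A \<longlonglongrightarrow> mat 1"
    "(\<lambda>n. t n *\<^sub>R (A n - mat 1)) \<longlonglongrightarrow> B"
    using B by (auto simp: limit_directions_def)
  have "(\<lambda>n. G ** A n ** G') \<longlonglongrightarrow> G ** mat 1 ** G'"
    by (intro tendsto_matrix_mult tendsto_const A)
  then have 1: "(\<lambda>n. G ** A n ** G') \<longlonglongrightarrow> mat 1"
    by (simp add: G)
  have eq: "G ** (t n *\<^sub>R (A n - mat 1)) ** G' = t n *\<^sub>R (G ** A n ** G' - mat 1)" for n
  proof -
    have "G ** (t n *\<^sub>R (A n - mat 1)) ** G' = t n *\<^sub>R (G ** A n ** G' - G ** G')"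
      by (simp add: matrix_2_simps) (simp add: algebra_simps)
    then show ?thesis by (simp add: G)
  qed
  have "(\<lambda>n. G ** (t n *\<^sub>R (A n - mat 1)) ** G') \<longlonglongrightarrow> G ** B ** G'"
    by (intro tendsto_matrix_mult tendsto_const A)
  then have "(\<lambda>n. t n *\<^sub>R (G ** A n ** G' - mat 1)) \<longlonglongrightarrow> G ** B ** G'"
    by (simp add: eq)
  then show ?thesis
    unfolding limit_directions_def using 1 A(1) S G
    by (intro CollectI exI[of _ "\<lambda>n. G ** A n ** G'"] exI[of _ t]) simp
qed

text \<open>For E = A - 1 the condition det A = 1 reads tr E = - det E. After scaling by t, the
  right side is a sum of products, each of a convergent entry of t E and an entry of E that tends to
  0.\<close>

lemma limit_directions_tracefree:
  assumes "S \<subseteq> carrier SL2R" "B \<in> limit_directions S"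
  shows "B$2$2 = - (B$1$1)"
proof -
  obtain A t where A: "\<And>n. A n \<in> S" "A \<longlonglongrightarrow> mat 1"
    and B: "(\<lambda>n. t n *\<^sub>R (A n - mat 1)) \<longlonglongrightarrow> B"
    using assms(2) by (auto simp: limit_directions_def)
  have det: "A n$1$1 * A n$2$2 - A n$1$2 * A n$2$1 = 1" for n
    using A(1) assms(1) by (auto simp: SL2R_def det_2[symmetric])
  let ?T = "\<lambda>n. t n *\<^sub>R (A n - mat 1)"
  let ?A = "\<lambda>n. A n - mat 1"
  have A0: "?A \<longlonglongrightarrow> 0"
    using tendsto_diff[OF A(2) tendsto_const[of "mat 1"]] by simp
  have "(\<lambda>n. ?T n$1$1 + ?T n$2$2) \<longlonglongrightarrow> B$1$1 + B$2$2"
    by (intro tendsto_intros B)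
  moreover have "(\<lambda>n. ?T n$1$2 * ?A n$2$1 - ?T n$1$1 * ?A n$2$2)
      \<longlonglongrightarrow> B$1$2 * (0::real^2^2)$2$1 - B$1$1 * (0::real^2^2)$2$2"
    by (intro tendsto_intros B A0)
  moreover have "?T n$1$1 + ?T n$2$2 = ?T n$1$2 * ?A n$2$1 - ?T n$1$1 * ?A n$2$2" for n
  proof -
    have "t n * (A n$1$1 * A n$2$2 - A n$1$2 * A n$2$1 - 1) = 0"
      by (simp add: det)
    then show ?thesis
      by (simp add: mat_def algebra_simps)
  qed
  ultimately have "B$1$1 + B$2$2 = 0"
    by (simp add: LIMSEQ_unique)
  then show ?thesis by simp
qed

text \<open>Scaling the differences from the identity to norm 1 puts them on the compact unit
  sphere; a subsequence converges there, and its limit is nonzero.\<close>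

lemma limit_directions_nonzero:
  fixes S :: "(real^2^2) set"
  assumes "\<And>e. e > 0 \<Longrightarrow> \<exists>A\<in>S. A \<noteq> mat 1 \<and> dist A (mat 1) < e"
  obtains B where "B \<in> limit_directions S" "B \<noteq> 0"
proof -
  have "\<forall>n. \<exists>A. A \<in> S \<and> A \<noteq> mat 1 \<and> dist A (mat 1) < inverse (real (Suc n))"
    using assms by (metis inverse_positive_iff_positive of_nat_0_less_iff zero_less_Suc)
  then obtain A where A: "\<And>n. A n \<in> S" "\<And>n. A n \<noteq> mat 1"
    "\<And>n. dist (A n) (mat 1) < inverse (real (Suc n))"
    by metis
  have lim: "A \<longlonglongrightarrow> mat 1"
    by (rule metric_tendsto_imp_tendsto[OF LIMSEQ_inverse_real_of_nat])
      (use A(3) in \<open>auto intro!: always_eventually less_imp_le simp: less_imp_le\<close>)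
  let ?B = "\<lambda>n. inverse (norm (A n - mat 1)) *\<^sub>R (A n - mat 1)"
  have sphere: "\<forall>n. ?B n \<in> sphere 0 1"
    using A(2) by simp
  obtain B r where B: "B \<in> sphere 0 1" "strict_mono r" "(?B \<circ> r) \<longlonglongrightarrow> B"
    by (rule seq_compactE[OF compact_imp_seq_compact[OF compact_sphere] sphere])
  have "B \<in> limit_directions S"
    unfolding limit_directions_def
    using A(1) B(3) LIMSEQ_subseq_LIMSEQ[OF lim B(2)]
    by (intro CollectI exI[of _ "A \<circ> r"] exI[of _ "\<lambda>n. inverse (norm (A (r n) - mat 1))"])
      (simp add: o_def)
  moreover have "B \<noteq> 0" using B(1) by auto
  ultimately show ?thesis by (rule that)
qed

section \<open>Subgroups of \<open>PSL2R\<close> and their preimages in \<open>SL2R\<close>\<close>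

context
  fixes \<Gamma> :: "(real^2^2) set set"
  assumes sub: "subgroup \<Gamma> PSL2R"
begin

lemma coset_in_subgroup_PSL2R: "G \<in> \<gamma> \<Longrightarrow> \<gamma> \<in> \<Gamma> \<Longrightarrow> \<gamma> = {G, - G}"
  using subgroup.subset[OF sub] by (auto simp: carrier_PSL2R)

lemma Union_subgroup_PSL2R_subset: "\<Union>\<Gamma> \<subseteq> carrier SL2R"
  using subgroup.subset[OF sub] Union_carrier_PSL2R by blast

lemma mult_PSL2R:
  assumes "A \<in> carrier SL2R" "B \<in> carrier SL2R"
  shows "{A, - A} \<otimes>\<^bsub>PSL2R\<^esub> {B, - B} = {A ** B, - (A ** B)}"
proof -
  interpret normal SL2R_center SL2R by (rule normal_SL2R_center)
  show ?thesis
    using rcos_sum[OF assms] unfolding SL2R_center_r_coset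
    by (simp add: PSL2R_def FactGroup_def) (simp add: SL2R_def)
qed

lemma Union_subgroup_PSL2R_mult:
  assumes "A \<in> \<Union>\<Gamma>" "B \<in> \<Union>\<Gamma>"
  shows "A ** B \<in> \<Union>\<Gamma>"
proof -
  have "{A, - A} \<in> \<Gamma>" "{B, - B} \<in> \<Gamma>"
    using assms coset_in_subgroup_PSL2R by blast+
  then have "{A, - A} \<otimes>\<^bsub>PSL2R\<^esub> {B, - B} \<in> \<Gamma>"
    by (rule subgroup.m_closed[OF sub])
  moreover have "A \<in> carrier SL2R" "B \<in> carrier SL2R"
    using assms Union_subgroup_PSL2R_subset by blast+
  ultimately show ?thesis
    by (auto simp: mult_PSL2R)
qed

lemma Union_subgroup_PSL2R_inverse:
  assumes "A \<in> \<Union>\<Gamma>"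
  obtains A' where "A' \<in> \<Union>\<Gamma>" "A ** A' = mat 1" "A' ** A = mat 1"
proof -
  have A: "{A, - A} \<in> \<Gamma>"
    using assms coset_in_subgroup_PSL2R by blast
  let ?i = "inv\<^bsub>PSL2R\<^esub> {A, - A}"
  have i: "?i \<in> \<Gamma>" by (rule subgroup.m_inv_closed[OF sub A])
  then obtain B where B: "B \<in> carrier SL2R" "?i = {B, - B}"
    using subgroup.subset[OF sub] by (auto simp: carrier_PSL2R)
  have "\<one>\<^bsub>PSL2R\<^esub> = {mat 1, - mat 1}"
    by (simp add: PSL2R_def FactGroup_def SL2R_center_def)
  moreover have "{A, - A} \<otimes>\<^bsub>PSL2R\<^esub> ?i = \<one>\<^bsub>PSL2R\<^esub>"
    using group.r_inv[OF group_PSL2R] A subgroup.subset[OF sub] by blast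
  moreover have "A \<in> carrier SL2R"
    using assms Union_subgroup_PSL2R_subset by blast
  ultimately have "{A ** B, - (A ** B)} = {mat 1, - mat 1}"
    using mult_PSL2R[OF _ B(1)] B(2) by simp
  \<comment> \<open>Equality of cosets determines the product only up to sign; the sign is absorbed
    by passing to \<open>- B\<close>, which lies in the same coset.\<close>
  then have "A ** B = mat 1 \<or> A ** (- B) = mat 1"
    by (auto simp: uminus_matrix_mul doubleton_eq_iff)
  moreover have "B \<in> \<Union>\<Gamma>" "- B \<in> \<Union>\<Gamma>" using i B by auto
  ultimately show ?thesis
    using that[of B] that[of "- B"] matrix_left_right_inverse[of A] by auto
qed

text \<open>If some ball around the identity met the preimage of the group only in the identity, its
  translates would isolate every element and the group would be discrete.\<close>

lemma nondiscrete_accumulates: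
  assumes nd: "\<not> discrete_PSL2R \<Gamma>" and e: "e > 0"
  shows "\<exists>A\<in>\<Union>\<Gamma>. A \<noteq> mat 1 \<and> dist A (mat 1) < e"
proof (rule ccontr)
  assume "\<not> ?thesis"
  then have iso: "A = mat 1" if "A \<in> \<Union>\<Gamma>" "dist A (mat 1) < e" for A
    using that by blast
  have "openin (subtopology PSL2R_topology \<Gamma>) {\<gamma>}" if \<gamma>: "\<gamma> \<in> \<Gamma>" for \<gamma>
  proof -
    obtain G where G: "G \<in> \<gamma>" "\<gamma> = {G, - G}"
      using \<gamma> subgroup.subset[OF sub] by (auto simp: carrier_PSL2R)
    then have GU: "G \<in> \<Union>\<Gamma>" using \<gamma> by blast
    then obtain G' where G': "G' \<in> \<Union>\<Gamma>" "G ** G' = mat 1" "G' ** G = mat 1"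
      by (rule Union_subgroup_PSL2R_inverse)
    \<comment> \<open>The right translate by \<open>G\<close> of the \<open>e\<close>-ball around
      the identity, made symmetric under negation so that its part in \<open>SL2R\<close> is a full
      preimage of a set of cosets.\<close>
    define V where "V = {A. dist (A ** G') (mat 1) < e \<or> dist ((- A) ** G') (mat 1) < e}"
    have cont: "continuous_on UNIV (\<lambda>A. A ** G')" "continuous_on UNIV (\<lambda>A. (- A) ** G')"
      by (auto simp: continuous_on_def intro!: tendsto_matrix_mult tendsto_intros)
    have "open V"
      unfolding V_def by (intro open_Collect_disj open_Collect_less continuous_intros cont)
    define U where "U = (\<lambda>A. {A, - A}) ` (carrier SL2R \<inter> V)"
    have "\<Union>U = carrier SL2R \<inter> V"
      by (auto simp: U_def V_def SL2R_def det_uminus_2)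
    then have "openin PSL2R_topology U"
      using \<open>open V\<close> by (auto simp: openin_PSL2R_topology U_def carrier_PSL2R)
    moreover have "{\<gamma>} = U \<inter> \<Gamma>"
    proof
      have "G \<in> V" using G' e by (simp add: V_def)
      then show "{\<gamma>} \<subseteq> U \<inter> \<Gamma>"
        using \<gamma> G GU Union_subgroup_PSL2R_subset by (auto simp: U_def)
    next
      show "U \<inter> \<Gamma> \<subseteq> {\<gamma>}"
      proof
        fix \<delta> assume "\<delta> \<in> U \<inter> \<Gamma>"
        then obtain A where A: "\<delta> = {A, - A}" "\<delta> \<in> \<Gamma>" "A \<in> V"
          by (auto simp: U_def)
        \<comment> \<open>Of the two representatives of \<open>\<delta>\<close>, the one for which
          the first disjunct in \<open>V\<close> holds.\<close>
        obtain A1 where A1: "\<delta> = {A1, - A1}" "dist (A1 ** G') (mat 1) < e"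
          using A that[of A] that[of "- A"] by (auto simp: V_def insert_commute)
        then have "A1 \<in> \<Union>\<Gamma>" using A by blast
        then have "A1 ** G' = mat 1"
          using iso A1 Union_subgroup_PSL2R_mult G' by blast
        then have "A1 = G"
          using arg_cong[of _ _ "\<lambda>M. M ** G"] G'(3)
          by (metis matrix_mul_assoc matrix_mul_lid matrix_mul_rid)
        then show "\<delta> \<in> {\<gamma>}" using A1 G by simp
      qed
    qed
    ultimately show ?thesis
      by (auto simp: openin_subtopology)
  qed
  moreover have "topspace (subtopology PSL2R_topology \<Gamma>) = \<Gamma>"
    using subgroup.subset[OF sub] by (auto simp: topspace_PSL2R_topology)
  ultimately have "discrete_topology \<Gamma> = subtopology PSL2R_topology \<Gamma>"
    by (subst discrete_topology_unique) blast
  then show False using nd by (simp add: discrete_PSL2R_def)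
qed

end

section \<open>Directions fixed up to scaling and elementary subgroups\<close>

text \<open>For trace-free \<open>C\<close> these are the eigenlines of \<open>C\<close> as points
  of the sphere, that is, the zeros of the vector field b + 2az - cz^2 of \<open>C\<close>. The
  point \<open>None\<close> stands for the line through (1, 0).\<close>

definition fixed_points :: "real^2^2 \<Rightarrow> sphere set" where
  "fixed_points C = {w. case w of None \<Rightarrow> C$2$1 = 0
     | Some z \<Rightarrow> of_real (C$2$1) * z\<^sup>2 - 2 * of_real (C$1$1) * z - of_real (C$1$2) = 0}"

lemma finite_fixed_points:
  assumes "C \<noteq> 0" "C$2$2 = - (C$1$1)"
  shows "finite (fixed_points C)"
proof -
  let ?p = "[:- of_real (C$1$2), - 2 * of_real (C$1$1), of_real (C$2$1):] :: complex poly"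
  have "?p \<noteq> 0"
    using assms by (auto simp: vec_eq_iff forall_2)
  then have "finite (insert None (Some ` {z. poly ?p z = 0}))"
    using poly_roots_finite by blast
  moreover have "fixed_points C \<subseteq> insert None (Some ` {z. poly ?p z = 0})"
  proof
    fix w assume "w \<in> fixed_points C"
    then show "w \<in> insert None (Some ` {z. poly ?p z = 0})"
      by (cases w) (simp_all add: fixed_points_def algebra_simps power2_eq_square)
  qed
  ultimately show ?thesis by (rule finite_subset[rotated])
qed

text \<open>The quadratic has real coefficients: either it has a real root, or its roots are
  conjugate and one of them has positive imaginary part. If the leading coefficient vanishes,
  infinity qualifies.\<close>

lemma fixed_points_closed_half_plane:
  "\<exists>w \<in> Some ` upper_half_plane \<union> Some ` range of_real \<union> {None}. w \<in> fixed_points C"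
proof (cases "C$2$1 = 0")
  case True
  then show ?thesis by (auto simp: fixed_points_def)
next
  case c: False
  define a b c where "a = C$1$1" and "b = C$1$2" and "c = C$2$1"
  have c0: "c \<noteq> 0" using c by (simp add: c_def)
  show ?thesis
  proof (cases "a\<^sup>2 + b * c \<ge> 0")
    case True
    define r where "r = (a + sqrt (a\<^sup>2 + b * c)) / c"
    have "(c * r - a)\<^sup>2 = a\<^sup>2 + b * c"
      using True c0 by (simp add: r_def)
    then have "c * (c * r\<^sup>2 - 2 * a * r - b) = 0"
      by (simp add: power2_eq_square algebra_simps)
    then have "c * r\<^sup>2 - 2 * a * r - b = 0"
      using c0 by simp
    from arg_cong[OF this, of complex_of_real]
    have "Some (of_real r) \<in> fixed_points C"
      by (simp add: fixed_points_def a_def b_def c_def)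
    then show ?thesis by blast
  next
    case False
    define s where "s = sqrt (- (a\<^sup>2 + b * c))"
    \<comment> \<open>The absolute value in s / |c| selects, for either sign of c, the root in the
      upper half-plane.\<close>
    define z where "z = Complex (a / c) (s / \<bar>c\<bar>)"
    have s: "s > 0" "s\<^sup>2 = - (a\<^sup>2 + b * c)"
      using False by (simp_all add: s_def)
    have "c * ((a / c)\<^sup>2 - (s / \<bar>c\<bar>)\<^sup>2) - 2 * a * (a / c) - b = - (a\<^sup>2 + b * c + s\<^sup>2) / c"
      using c0 by (simp add: power_divide) (simp add: field_simps power2_eq_square)
    then have "c * ((a / c)\<^sup>2 - (s / \<bar>c\<bar>)\<^sup>2) - 2 * a * (a / c) - b = 0"
      by (simp add: s(2))
    then have "of_real c * z\<^sup>2 - 2 * of_real a * z - of_real b = 0"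
      using c0 by (simp add: z_def complex_eq_iff power2_eq_square)
    then have "Some z \<in> fixed_points C"
      by (simp add: fixed_points_def a_def b_def c_def)
    moreover have "z \<in> upper_half_plane"
      using s c0 by (simp add: z_def upper_half_plane_def)
    ultimately show ?thesis by blast
  qed
qed

text \<open>The quadratic form is \<open>det (v, C v)\<close>, which \<open>SL2R\<close> preserves.\<close>

lemma fixed_form_transform:
  fixes a b c k p q r s x y :: "'a::comm_ring_1"
  assumes "p * s - q * r = 1"
    and "p * a + q * c = k * (a * p + b * r)" "p * b - q * a = k * (a * q + b * s)"
    and "r * a + s * c = k * (c * p - a * r)" "r * b - s * a = k * (c * q - a * s)"
  shows "k * (c * (p * x + q * y)\<^sup>2 - 2 * a * (p * x + q * y) * (r * x + s * y)
      - b * (r * x + s * y)\<^sup>2) = c * x\<^sup>2 - 2 * a * x * y - b * y\<^sup>2"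
proof -
  \<comment> \<open>With v = (x, y) and Q(v) = det(v, Cv), the chain is k Q(Gv) = det(Gv, k C G v) =
    det(Gv, G C v) = det(G) Q(v). The hypotheses are the entries of GC = k CG for trace-free
    C.\<close>
  have "k * (c * (p * x + q * y)\<^sup>2 - 2 * a * (p * x + q * y) * (r * x + s * y)
      - b * (r * x + s * y)\<^sup>2)
    = (p * x + q * y) * (k * (c * p - a * r) * x + k * (c * q - a * s) * y)
      - (r * x + s * y) * (k * (a * p + b * r) * x + k * (a * q + b * s) * y)"
    by (simp add: power2_eq_square algebra_simps)
  also have "\<dots> = (p * x + q * y) * ((r * a + s * c) * x + (r * b - s * a) * y)
      - (r * x + s * y) * ((p * a + q * c) * x + (p * b - q * a) * y)"
    by (simp only: assms)
  also have "\<dots> = (p * s - q * r) * (c * x\<^sup>2 - 2 * a * x * y - b * y\<^sup>2)"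
    by (simp add: power2_eq_square algebra_simps)
  finally show ?thesis by (simp add: assms(1))
qed

text \<open>The relation makes \<open>G\<close> map eigenlines of \<open>C\<close> to eigenlines:
  the quadratic form vanishes at Gv whenever it vanishes at v, because \<open>k\<close> can be
  cancelled.\<close>

lemma fixed_points_invariant:
  assumes G: "det G = 1" and C: "C$2$2 = - (C$1$1)"
    and k: "G ** C = k *\<^sub>R (C ** G)" "k \<noteq> 0"
    and w: "w \<in> fixed_points C"
  shows "moebius_SL2R G w \<in> fixed_points C"
proof -
  define a b c where "a = complex_of_real (C$1$1)" and "b = complex_of_real (C$1$2)"
    and "c = complex_of_real (C$2$1)"
  define p q r s where "p = complex_of_real (G$1$1)" and "q = complex_of_real (G$1$2)"
    and "r = complex_of_real (G$2$1)" and "s = complex_of_real (G$2$2)"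
  note defs = a_def b_def c_def p_def q_def r_def s_def
  have "G$1$1 * G$2$2 - G$1$2 * G$2$1 = 1"
    using G by (simp add: det_2)
  from arg_cong[OF this, of complex_of_real] have det: "p * s - q * r = 1"
    by (simp add: defs)
  have "(G ** C)$i$j = k * (C ** G)$i$j" for i j
    using k(1) by simp
  from this[of 1 1] this[of 1 2] this[of 2 1] this[of 2 2]
  have "G$1$1 * C$1$1 + G$1$2 * C$2$1 = k * (C$1$1 * G$1$1 + C$1$2 * G$2$1)"
    "G$1$1 * C$1$2 - G$1$2 * C$1$1 = k * (C$1$1 * G$1$2 + C$1$2 * G$2$2)"
    "G$2$1 * C$1$1 + G$2$2 * C$2$1 = k * (C$2$1 * G$1$1 - C$1$1 * G$2$1)"
    "G$2$1 * C$1$2 - G$2$2 * C$1$1 = k * (C$2$1 * G$1$2 - C$1$1 * G$2$2)"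
    by (simp_all add: matrix_matrix_mult_def sum_2 C)
  from this[THEN arg_cong, of complex_of_real]
  have "p * a + q * c = of_real k * (a * p + b * r)"
    "p * b - q * a = of_real k * (a * q + b * s)"
    "r * a + s * c = of_real k * (c * p - a * r)"
    "r * b - s * a = of_real k * (c * q - a * s)"
    by (simp_all add: defs)
  note transform = fixed_form_transform[OF det this]
  have form: "c * (p * x + q * y)\<^sup>2 - 2 * a * (p * x + q * y) * (r * x + s * y)
      - b * (r * x + s * y)\<^sup>2 = 0" if "c * x\<^sup>2 - 2 * a * x * y - b * y\<^sup>2 = 0" for x y
    using transform[of x y] that k(2) by simp
  \<comment> \<open>Homogeneous coordinates treat both kinds of points at once: (z, 1) is a finite
    point and (1, 0) is infinity.\<close>
  have mem: "(if r * x + s * y = 0 then None else Some ((p * x + q * y) / (r * x + s * y)))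
      \<in> fixed_points C"
    if "c * x\<^sup>2 - 2 * a * x * y - b * y\<^sup>2 = 0" "x \<noteq> 0 \<or> y \<noteq> 0" for x y
  proof (cases "r * x + s * y = 0")
    case True
    \<comment> \<open>As \<open>G\<close> is invertible, the image vector is nonzero; with second
      coordinate 0, the vanishing form then leaves only c = 0.\<close>
    have "p * x + q * y \<noteq> 0"
    proof
      assume 0: "p * x + q * y = 0"
      have "(p * s - q * r) * x = s * (p * x + q * y) - q * (r * x + s * y)"
        "(p * s - q * r) * y = p * (r * x + s * y) - r * (p * x + q * y)"
        by (simp_all add: algebra_simps)
      then show False using that(2) True 0 det by simp
    qed
    then have "c = 0" using form[OF that(1)] True by simp
    then show ?thesis using True by (simp add: fixed_points_def c_def)
  next
    case False
    let ?x = "p * x + q * y" and ?y = "r * x + s * y"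
    have "c * (?x / ?y)\<^sup>2 - 2 * a * (?x / ?y) - b
      = (c * ?x\<^sup>2 - 2 * a * ?x * ?y - b * ?y\<^sup>2) / ?y\<^sup>2"
      using False by (simp add: power_divide diff_divide_distrib power2_eq_square)
    also have "\<dots> = 0" using form[OF that(1)] by simp
    finally show ?thesis using False by (simp add: fixed_points_def defs)
  qed
  show ?thesis
  proof (cases w)
    case None
    then have "moebius_SL2R G w
        = (if r * 1 + s * 0 = 0 then None else Some ((p * 1 + q * 0) / (r * 1 + s * 0)))"
      by (simp add: defs)
    moreover have "c * 1\<^sup>2 - 2 * a * 1 * 0 - b * 0\<^sup>2 = 0"
      using w None by (simp add: fixed_points_def defs)
    ultimately show ?thesis using mem[of 1 0] by (simp only: one_neq_zero simp_thms)
  next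
    case (Some z)
    then have "moebius_SL2R G w
        = (if r * z + s * 1 = 0 then None else Some ((p * z + q * 1) / (r * z + s * 1)))"
      by (simp add: defs moebius_def)
    moreover have "c * z\<^sup>2 - 2 * a * z * 1 - b * 1\<^sup>2 = 0"
      using w Some by (simp add: fixed_points_def defs)
    ultimately show ?thesis using mem[of z 1] by (simp only: one_neq_zero simp_thms)
  qed
qed

lemma elementary_if_fixed_direction:
  assumes sub: "subgroup \<Gamma> PSL2R" and C: "C \<noteq> 0" "C$2$2 = - (C$1$1)"
    and inv: "\<And>G. G \<in> \<Union>\<Gamma> \<Longrightarrow> \<exists>k. k \<noteq> 0 \<and> G ** C = k *\<^sub>R (C ** G)"
  shows "elementary \<Gamma>"
proof -
  obtain w where w: "w \<in> Some ` upper_half_plane \<union> Some ` range of_real \<union> {None}"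
    "w \<in> fixed_points C"
    using fixed_points_closed_half_plane by blast
  have "moebius_PSL2R \<gamma> w \<in> fixed_points C" if \<gamma>: "\<gamma> \<in> \<Gamma>" for \<gamma>
  proof -
    obtain G where G: "\<gamma> = {G, - G}" "det G = 1"
      using \<gamma> subgroup.subset[OF sub] by (auto simp: carrier_PSL2R SL2R_def)
    then obtain k where "k \<noteq> 0" "G ** C = k *\<^sub>R (C ** G)"
      using inv[of G] \<gamma> by blast
    moreover have "moebius_PSL2R \<gamma> w = moebius_SL2R G w"
      by (simp add: G(1) moebius_PSL2R_coset flip: SL2R_center_r_coset)
    ultimately show ?thesis
      using fixed_points_invariant[OF G(2) C(2)] w(2) by metis
  qed
  then have "(\<lambda>\<gamma>. moebius_PSL2R \<gamma> w) ` \<Gamma> \<subseteq> fixed_points C" by blast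
  then show ?thesis
    unfolding elementary_def
    using w(1) finite_subset[OF _ finite_fixed_points[OF C]] by blast
qed

section \<open>Brackets of trace-free matrices and invariant planes\<close>

lemma cross_parallel:
  fixes a b c a' b' c' l1 l2 l3 :: "'a::field"
  assumes "l1 * a + l2 * b + l3 * c = 0" "l1 * a' + l2 * b' + l3 * c' = 0"
    and "l1 \<noteq> 0 \<or> l2 \<noteq> 0 \<or> l3 \<noteq> 0"
  obtains m where "b * c' - c * b' = m * l1" "c * a' - a * c' = m * l2" "a * b' - b * a' = m * l3"
proof -
  \<comment> \<open>Each identity eliminates one of the three terms from the two equations; together
    they say that the cross product is parallel to (l1, l2, l3).\<close>
  have *: "(c * a' - a * c') * l1 = (b * c' - c * b') * l2"
    "(a * b' - b * a') * l1 = (b * c' - c * b') * l3"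
    "(a * b' - b * a') * l2 = (c * a' - a * c') * l3"
    using assms(1,2) by algebra+
  consider "l1 \<noteq> 0" | "l2 \<noteq> 0" | "l3 \<noteq> 0" using assms(3) by blast
  then show ?thesis
  proof cases
    case 1
    show ?thesis
      by (rule that[of "(b * c' - c * b') / l1"])
        (use 1 * in \<open>auto simp: nonzero_eq_divide_eq nonzero_divide_eq_eq\<close>)
  next
    case 2
    show ?thesis
      by (rule that[of "(c * a' - a * c') / l2"])
        (use 2 * in \<open>auto simp: nonzero_eq_divide_eq nonzero_divide_eq_eq\<close>)
  next
    case 3
    show ?thesis
      by (rule that[of "(a * b' - b * a') / l3"])
        (use 3 * in \<open>auto simp: nonzero_eq_divide_eq nonzero_divide_eq_eq\<close>)
  qed
qed

definition matrix_bracket :: "real^2^2 \<Rightarrow> real^2^2 \<Rightarrow> real^2^2" where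
  "matrix_bracket X Y = X ** Y - Y ** X"

text \<open>In the coordinates (X11, X12, X21) the bracket is the cross product with its last two
  components swapped and doubled. This turns statements about lines and planes of matrices into
  vector algebra.\<close>

lemma matrix_bracket_tracefree:
  assumes "X$2$2 = - (X$1$1)" "Y$2$2 = - (Y$1$1)"
  shows "matrix_bracket X Y $1$1 = X$1$2 * Y$2$1 - X$2$1 * Y$1$2"
    "matrix_bracket X Y $1$2 = 2 * (X$1$1 * Y$1$2 - X$1$2 * Y$1$1)"
    "matrix_bracket X Y $2$1 = 2 * (X$2$1 * Y$1$1 - X$1$1 * Y$2$1)"
    "matrix_bracket X Y $2$2 = - (matrix_bracket X Y $1$1)"
  using assms by (simp_all add: matrix_bracket_def matrix_matrix_mult_def sum_2 algebra_simps)

lemma matrix_bracket_conjugate: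
  assumes "G' ** G = mat 1"
  shows "G ** matrix_bracket X Y ** G' = matrix_bracket (G ** X ** G') (G ** Y ** G')"
proof -
  have *: "G ** X ** G' ** (G ** Y ** G') = G ** (X ** Y) ** G'" for X Y
    by (metis assms matrix_mul_assoc matrix_mul_rid)
  show ?thesis
    unfolding matrix_bracket_def *
    by (simp add: matrix_2_simps) (simp add: algebra_simps)
qed

lemma matrix_bracket_eq_0:
  assumes "X \<noteq> 0" "X$2$2 = - (X$1$1)" "Y$2$2 = - (Y$1$1)" "matrix_bracket X Y = 0"
  shows "\<exists>k. Y = k *\<^sub>R X"
proof -
  have *: "X$1$2 * Y$2$1 = X$2$1 * Y$1$2" "X$1$1 * Y$1$2 = X$1$2 * Y$1$1"
    "X$2$1 * Y$1$1 = X$1$1 * Y$2$1"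
    using matrix_bracket_tracefree[OF assms(2,3)] assms(4) by simp_all
  consider "X$1$1 \<noteq> 0" | "X$1$2 \<noteq> 0" | "X$2$1 \<noteq> 0"
    using assms(1,2) by (auto simp: vec_eq_iff forall_2)
  then show ?thesis
  proof cases
    case 1
    show ?thesis
      by (rule exI[of _ "Y$1$1 / X$1$1"])
        (use 1 * assms(2,3) in \<open>auto simp: vec_eq_iff forall_2 field_simps\<close>)
  next
    case 2
    show ?thesis
      by (rule exI[of _ "Y$1$2 / X$1$2"])
        (use 2 * assms(2,3) in \<open>auto simp: vec_eq_iff forall_2 field_simps\<close>)
  next
    case 3
    show ?thesis
      by (rule exI[of _ "Y$2$1 / X$2$1"])
        (use 3 * assms(2,3) in \<open>auto simp: vec_eq_iff forall_2 field_simps\<close>)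
  qed
qed

lemma matrix_bracket_parallel:
  assumes l: "l1 \<noteq> 0 \<or> l2 \<noteq> 0 \<or> l3 \<noteq> (0::real)"
    and D: "\<And>B. B \<in> D \<Longrightarrow> B$2$2 = - (B$1$1)"
      "\<And>B. B \<in> D \<Longrightarrow> l1 * B$1$1 + l2 * B$1$2 + l3 * B$2$1 = 0"
    and XY: "X \<in> D" "Y \<in> D" "X0 \<in> D" "Y0 \<in> D" "matrix_bracket X0 Y0 \<noteq> 0"
  shows "\<exists>k. matrix_bracket X Y = k *\<^sub>R matrix_bracket X0 Y0"
proof -
  \<comment> \<open>The normal of the plane for the trace form: tr(L B) = 2 (l1 B11 + l2 B12 + l3
    B21) for trace-free B. Every bracket of two elements of \<open>D\<close> is a multiple of
    it.\<close>
  define L :: "real^2^2" where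
    "L = (\<chi> i j. if i = 1 then (if j = 1 then l1 else 2 * l3) else (if j = 1 then 2 * l2 else - l1))"
  have *: "\<exists>m. matrix_bracket X Y = m *\<^sub>R L" if XY: "X \<in> D" "Y \<in> D" for X Y
  proof -
    obtain m where "X$1$2 * Y$2$1 - X$2$1 * Y$1$2 = m * l1"
      "X$2$1 * Y$1$1 - X$1$1 * Y$2$1 = m * l2" "X$1$1 * Y$1$2 - X$1$2 * Y$1$1 = m * l3"
      using cross_parallel[OF D(2)[OF XY(1)] D(2)[OF XY(2)] l] by blast
    then have "matrix_bracket X Y = m *\<^sub>R L"
      using matrix_bracket_tracefree[OF D(1) D(1)] XY
      by (simp add: vec_eq_iff forall_2 L_def)
    then show ?thesis ..
  qed
  obtain m m0 where m: "matrix_bracket X Y = m *\<^sub>R L" "matrix_bracket X0 Y0 = m0 *\<^sub>R L"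
    using * XY by blast
  then have "matrix_bracket X Y = (m / m0) *\<^sub>R matrix_bracket X0 Y0"
    using XY(5) by auto
  then show ?thesis ..
qed

text \<open>An invariant proper subspace of the trace-free matrices is a line or a plane; in a plane
  the bracket of two independent elements spans the orthogonal line of the Killing form.\<close>

lemma fixed_direction_exists:
  fixes S :: "(real^2^2) set"
  assumes inv: "\<And>G. G \<in> S \<Longrightarrow> \<exists>G'\<in>S. G ** G' = mat 1"
    and conj: "\<And>G G' B. G \<in> S \<Longrightarrow> G' \<in> S \<Longrightarrow> G ** G' = mat 1 \<Longrightarrow> B \<in> D \<Longrightarrow> G ** B ** G' \<in> D"
    and D: "\<And>B. B \<in> D \<Longrightarrow> B$2$2 = - (B$1$1)"
      "\<And>B. B \<in> D \<Longrightarrow> l1 * B$1$1 + l2 * B$1$2 + l3 * B$2$1 = 0"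
    and l: "l1 \<noteq> 0 \<or> l2 \<noteq> 0 \<or> l3 \<noteq> (0::real)"
    and X: "X \<in> D" "X \<noteq> 0"
  obtains C where "C \<noteq> 0" "C$2$2 = - (C$1$1)"
    "\<And>G. G \<in> S \<Longrightarrow> \<exists>k. k \<noteq> 0 \<and> G ** C = k *\<^sub>R (C ** G)"
proof -
  have "\<exists>C. C \<noteq> 0 \<and> C$2$2 = - (C$1$1) \<and>
    (\<forall>G\<in>S. \<forall>G'\<in>S. G ** G' = mat 1 \<longrightarrow> (\<exists>k. G ** C ** G' = k *\<^sub>R C))"
  proof (cases "\<forall>Y\<in>D. \<exists>k. Y = k *\<^sub>R X")
    case True
    show ?thesis
      by (rule exI[of _ X]) (use True X D conj in auto)
  next
    case False
    then obtain Y where Y: "Y \<in> D" "\<nexists>k. Y = k *\<^sub>R X" by blast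
    have nz: "matrix_bracket X Y \<noteq> 0"
      using matrix_bracket_eq_0 Y X D(1) by blast
    \<comment> \<open>Conjugation respects brackets and keeps \<open>X\<close> and \<open>Y\<close>
      inside \<open>D\<close>, so the conjugated bracket is again a bracket of elements of
      \<open>D\<close> and lies on the same line.\<close>
    have "\<exists>k. G ** matrix_bracket X Y ** G' = k *\<^sub>R matrix_bracket X Y"
      if G: "G \<in> S" "G' \<in> S" "G ** G' = mat 1" for G G'
      unfolding matrix_bracket_conjugate[OF G(3)[unfolded matrix_left_right_inverse[of G]]]
      by (rule matrix_bracket_parallel[OF l D]) (use G X Y conj nz in auto)
    then show ?thesis
      using nz matrix_bracket_tracefree(4)[OF D(1) D(1)] X Y by blast
  qed
  then obtain C where C: "C \<noteq> 0" "C$2$2 = - (C$1$1)"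
    "\<And>G G'. G \<in> S \<Longrightarrow> G' \<in> S \<Longrightarrow> G ** G' = mat 1 \<Longrightarrow> \<exists>k. G ** C ** G' = k *\<^sub>R C"
    by blast
  show ?thesis
  proof (rule that[OF C(1,2)])
    fix G assume G: "G \<in> S"
    then obtain G' where G': "G' \<in> S" "G ** G' = mat 1" using inv by blast
    then have G'': "G' ** G = mat 1" using matrix_left_right_inverse by blast
    obtain k where k: "G ** C ** G' = k *\<^sub>R C" using C(3) G G' by blast
    have "G ** C = (G ** C ** G') ** G"
      by (simp add: G'' flip: matrix_mul_assoc)
    also have "\<dots> = k *\<^sub>R (C ** G)"
      by (simp add: k) (simp add: matrix_2_simps algebra_simps)
    finally have eq: "G ** C = k *\<^sub>R (C ** G)" .
    have "k \<noteq> 0"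
    proof
      assume "k = 0"
      then have "G ** C = 0" by (simp add: eq)
      then have "G' ** (G ** C) = 0"
        by (simp add: matrix_2_simps)
      then show False using C(1) G'' by (simp add: matrix_mul_assoc)
    qed
    with eq show "\<exists>k. k \<noteq> 0 \<and> G ** C = k *\<^sub>R (C ** G)" by blast
  qed
qed

section \<open>The infinitesimal equivariance equation\<close>

abbreviation moebius_matrix :: "real^2^2 \<Rightarrow> complex \<Rightarrow> complex" where
  "moebius_matrix A \<equiv> moebius (of_real (A$1$1)) (of_real (A$1$2)) (of_real (A$2$1)) (of_real (A$2$2))"

text \<open>The first-order term in e of the action of 1 + eB on z. It is linear in
  \<open>B\<close>.\<close>

definition moebius_field :: "real^2^2 \<Rightarrow> complex \<Rightarrow> complex" where
  "moebius_field B z =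
     of_real (B$1$2) + (of_real (B$1$1) - of_real (B$2$2)) * z - of_real (B$2$1) * z\<^sup>2"

lemma tendsto_moebius_matrix:
  assumes "A \<longlonglongrightarrow> mat 1"
  shows "(\<lambda>n. moebius_matrix (A n) z) \<longlonglongrightarrow> z"
proof -
  have "(\<lambda>n. moebius_matrix (A n) z) \<longlonglongrightarrow> moebius_matrix (mat 1) z"
    unfolding moebius_def by (intro tendsto_intros assms) (simp add: mat_def)
  then show ?thesis by (simp add: mat_def moebius_def)
qed

text \<open>The identity Az - z = v(z) / (cz + d), with v the field of A - 1, is exact, so no
  remainder has to be estimated: the numerator is linear in A - 1 and the denominator tends to
  1.\<close>

lemma tendsto_moebius_field:
  assumes A: "A \<longlonglongrightarrow> mat 1" and B: "(\<lambda>n. t n *\<^sub>R (A n - mat 1)) \<longlonglongrightarrow> B"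
  shows "(\<lambda>n. of_real (t n) * (moebius_matrix (A n) z - z)) \<longlonglongrightarrow> moebius_field B z"
proof -
  let ?T = "\<lambda>n. t n *\<^sub>R (A n - mat 1)"
  let ?d = "\<lambda>n. of_real (A n$2$1) * z + of_real (A n$2$2)"
  have d: "?d \<longlonglongrightarrow> of_real ((mat 1 :: real^2^2)$2$1) * z + of_real ((mat 1 :: real^2^2)$2$2)"
    by (intro tendsto_intros A)
  then have d: "?d \<longlonglongrightarrow> 1" by (simp add: mat_def)
  have "(\<lambda>n. moebius_field (?T n) z / ?d n) \<longlonglongrightarrow> moebius_field B z / 1"
    unfolding moebius_field_def by (intro tendsto_intros B d) simp
  moreover have "\<forall>\<^sub>F n in sequentially.
      moebius_field (?T n) z / ?d n = of_real (t n) * (moebius_matrix (A n) z - z)"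
    using tendsto_imp_eventually_ne[OF d, of 0, simplified]
  proof eventually_elim
    case (elim n)
    have "moebius_matrix (A n) z - z = (of_real (A n$1$1) * z + of_real (A n$1$2) - z * ?d n) / ?d n"
      using elim by (simp add: moebius_def diff_divide_distrib)
    moreover have "moebius_field (?T n) z
        = of_real (t n) * (of_real (A n$1$1) * z + of_real (A n$1$2) - z * ?d n)"
      by (simp add: moebius_field_def mat_def power2_eq_square algebra_simps)
    ultimately show ?case by simp
  qed
  ultimately show ?thesis
    by (auto intro: Lim_transform_eventually)
qed

lemma infinitesimal_equivariance:
  assumes f: "(f has_field_derivative p) (at z)"
    and A: "A \<longlonglongrightarrow> mat 1" and B: "(\<lambda>n. t n *\<^sub>R (A n - mat 1)) \<longlonglongrightarrow> B"
    and eq: "\<forall>\<^sub>F n in sequentially. f (moebius_matrix (A n) z) = moebius_matrix (A n) (f z)"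
  shows "p * moebius_field B z = moebius_field B (f z)"
proof -
  \<comment> \<open>Caratheodory's form of the derivative avoids dividing by the displacement of
    \<open>z\<close>, which may be 0 for infinitely many n.\<close>
  obtain g where g: "\<And>u. f u - f z = g u * (u - z)" "isCont g z" "g z = p"
    using f unfolding CARAT_DERIV by blast
  have "(\<lambda>n. g (moebius_matrix (A n) z)) \<longlonglongrightarrow> p"
    using isCont_tendsto_compose[OF g(2) tendsto_moebius_matrix[OF A]] g(3) by simp
  then have "(\<lambda>n. g (moebius_matrix (A n) z) * (of_real (t n) * (moebius_matrix (A n) z - z)))
      \<longlonglongrightarrow> p * moebius_field B z"
    by (intro tendsto_mult tendsto_moebius_field[OF A B])
  moreover have "\<forall>\<^sub>F n in sequentially.
      g (moebius_matrix (A n) z) * (of_real (t n) * (moebius_matrix (A n) z - z))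
      = of_real (t n) * (moebius_matrix (A n) (f z) - f z)"
    using eq
  proof eventually_elim
    case (elim n)
    have "moebius_matrix (A n) (f z) - f z
        = g (moebius_matrix (A n) z) * (moebius_matrix (A n) z - z)"
      using g(1)[of "moebius_matrix (A n) z"] by (simp only: elim)
    then show ?case by (simp only: mult_ac)
  qed
  ultimately have "(\<lambda>n. of_real (t n) * (moebius_matrix (A n) (f z) - f z))
      \<longlonglongrightarrow> p * moebius_field B z"
    by (rule Lim_transform_eventually)
  then show ?thesis
    using tendsto_moebius_field[OF A B] LIMSEQ_unique by blast
qed

section \<open>Rigidity\<close>

lemma equivariant_at_regular_point:
  assumes sub: "subgroup \<Gamma> PSL2R"
    and f: "f nicely_meromorphic_on upper_half_plane"
    and h: "h = (\<lambda>z\<in>upper_half_plane. if is_pole f z then None else Some (f z))"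
    and equi: "\<And>\<gamma> z. \<gamma> \<in> \<Gamma> \<Longrightarrow> z \<in> upper_half_plane \<Longrightarrow>
      h (the (moebius_PSL2R \<gamma> (Some z))) = moebius_PSL2R \<gamma> (h z)"
    and z: "z \<in> upper_half_plane" "\<not> is_pole f z"
    and B: "B \<in> limit_directions (\<Union>\<Gamma>)"
  shows "deriv f z * moebius_field B z = moebius_field B (f z)"
proof -
  obtain A t where A: "\<And>n. A n \<in> \<Union>\<Gamma>" "A \<longlonglongrightarrow> mat 1"
    and AB: "(\<lambda>n. t n *\<^sub>R (A n - mat 1)) \<longlonglongrightarrow> B"
    using B by (auto simp: limit_directions_def)
  have an: "f analytic_on {z}"
    by (rule nicely_meromorphic_on_imp_analytic_at[OF f z])
  then have deriv: "(f has_field_derivative deriv f z) (at z)"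
    by (metis analytic_on_imp_differentiable_at insertI1 DERIV_deriv_iff_field_differentiable)
  have "\<forall>\<^sub>F u in nhds z. \<not> is_pole f u"
    using eventually_not_pole[of f z] an z(2)
    by (auto simp: eventually_nhds_conv_at isolated_singularity_at_analytic)
  moreover have "open upper_half_plane"
    unfolding upper_half_plane_def by (rule open_halfspace_Im_gt)
  ultimately have "\<forall>\<^sub>F u in nhds z. u \<in> upper_half_plane \<and> \<not> is_pole f u"
    using z(1) by (intro eventually_conj eventually_nhds_in_open)
  then have "\<forall>\<^sub>F n in sequentially. moebius_matrix (A n) z \<in> upper_half_plane
      \<and> \<not> is_pole f (moebius_matrix (A n) z)"
    by (rule eventually_compose_filterlim[OF _ tendsto_moebius_matrix[OF A(2)]])
  then have "\<forall>\<^sub>F n in sequentially. f (moebius_matrix (A n) z) = moebius_matrix (A n) (f z)"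
  proof eventually_elim
    case (elim n)
    obtain \<gamma> where \<gamma>: "\<gamma> \<in> \<Gamma>" "A n \<in> \<gamma>" using A(1)[of n] by blast
    then have "\<gamma> = {A n, - A n}" by (rule coset_in_subgroup_PSL2R[OF sub, rotated])
    then have act: "moebius_PSL2R \<gamma> w = moebius_SL2R (A n) w" for w
      by (simp add: moebius_PSL2R_coset flip: SL2R_center_r_coset)
    have "\<gamma> \<in> carrier PSL2R" using \<gamma>(1) subgroup.subset[OF sub] by blast
    then have "moebius_SL2R (A n) (Some z) \<in> Some ` upper_half_plane"
      using moebius_PSL2R_upper_half_plane[OF _ z(1)] by (metis act)
    then have "moebius_SL2R (A n) (Some z) = Some (moebius_matrix (A n) z)"
      by (auto split: if_splits)
    then have "h (moebius_matrix (A n) z) = moebius_SL2R (A n) (h z)"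
      using equi[OF \<gamma>(1) z(1)] by (simp only: act option.sel)
    \<comment> \<open>The image of \<open>z\<close> is not a pole, so the left side is finite. Hence
      the right side is not \<open>None\<close>, and the denominator of \<open>A n\<close> at
      \<open>f z\<close> is nonzero.\<close>
    then show ?case
      using z elim by (simp add: h split: if_splits)
  qed
  with deriv A(2) AB show ?thesis
    by (rule infinitesimal_equivariance)
qed

text \<open>For fixed p, z and w the hypothesis is one complex linear relation on the entries of
  \<open>B\<close>. If w and z differ, it is nontrivial, so all limit directions lie in a proper
  real subspace and the group is elementary.\<close>

lemma regular_point_fixed:
  assumes sub: "subgroup \<Gamma> PSL2R" and nd: "\<not> discrete_PSL2R \<Gamma>" and ne: "\<not> elementary \<Gamma>"
    and eq: "\<And>B. B \<in> limit_directions (\<Union>\<Gamma>) \<Longrightarrow> p * moebius_field B z = moebius_field B w"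
  shows "w = z"
proof (rule ccontr)
  assume "w \<noteq> z"
  let ?D = "limit_directions (\<Union>\<Gamma>)"
  define l1 l2 l3 where "l1 = 2 * (p * z - w)" and "l2 = p - 1" and "l3 = - (p * z\<^sup>2 - w\<^sup>2)"
  have tracefree: "B$2$2 = - (B$1$1)" if "B \<in> ?D" for B
    by (rule limit_directions_tracefree[OF Union_subgroup_PSL2R_subset[OF sub] that])
  have l: "l1 * of_real (B$1$1) + l2 * of_real (B$1$2) + l3 * of_real (B$2$1) = 0"
    if "B \<in> ?D" for B
    using eq[OF that] tracefree[OF that]
    by (simp add: moebius_field_def l1_def l2_def l3_def algebra_simps)
  \<comment> \<open>If \<open>l2 = 0\<close> then p = 1, and then \<open>l1 = 0\<close> would give w
    = z.\<close>
  have "l1 \<noteq> 0 \<or> l2 \<noteq> 0"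
    using \<open>w \<noteq> z\<close> by (auto simp: l1_def l2_def)
  then have nz: "(Re l1 \<noteq> 0 \<or> Re l2 \<noteq> 0 \<or> Re l3 \<noteq> 0) \<or> (Im l1 \<noteq> 0 \<or> Im l2 \<noteq> 0 \<or> Im l3 \<noteq> 0)"
    by (auto simp: complex_eq_iff)
  \<comment> \<open>Since \<open>B\<close> has real entries, the complex relation splits into two
    real ones, at least one of them nontrivial.\<close>
  have re: "Re l1 * B$1$1 + Re l2 * B$1$2 + Re l3 * B$2$1 = 0"
    and im: "Im l1 * B$1$1 + Im l2 * B$1$2 + Im l3 * B$2$1 = 0" if "B \<in> ?D" for B
    using arg_cong[OF l[OF that], of Re] arg_cong[OF l[OF that], of Im] by simp_all
  obtain X where X: "X \<in> ?D" "X \<noteq> 0"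
    using limit_directions_nonzero[OF nondiscrete_accumulates[OF sub nd]] by blast
  have inv: "\<exists>G'\<in>\<Union>\<Gamma>. G ** G' = mat 1" if "G \<in> \<Union>\<Gamma>" for G
    using Union_subgroup_PSL2R_inverse[OF sub that] by metis
  have conj: "G ** B ** G' \<in> ?D"
    if "G \<in> \<Union>\<Gamma>" "G' \<in> \<Union>\<Gamma>" "G ** G' = mat 1" "B \<in> ?D" for G G' B
    by (rule limit_directions_conjugate[OF Union_subgroup_PSL2R_mult[OF sub] that])
  have elem: "elementary \<Gamma>"
    if m: "m1 \<noteq> 0 \<or> m2 \<noteq> 0 \<or> m3 \<noteq> (0::real)"
      "\<And>B. B \<in> ?D \<Longrightarrow> m1 * B$1$1 + m2 * B$1$2 + m3 * B$2$1 = 0" for m1 m2 m3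
  proof (rule fixed_direction_exists[OF inv conj tracefree m(2) m(1) X])
    fix C :: "real^2^2"
    assume "C \<noteq> 0" "C$2$2 = - (C$1$1)"
      "\<And>G. G \<in> \<Union>\<Gamma> \<Longrightarrow> \<exists>k. k \<noteq> 0 \<and> G ** C = k *\<^sub>R (C ** G)"
    then show ?thesis by (rule elementary_if_fixed_direction[OF sub])
  qed
  from nz have "elementary \<Gamma>"
    using elem[OF _ re] elem[OF _ im] by blast
  with ne show False ..
qed

lemma identity_equivariant:
  assumes "\<Gamma> \<subseteq> carrier PSL2R"
  shows "(\<lambda>z\<in>upper_half_plane. Some z) \<in> equivariant_functions \<Gamma>"
proof -
  have "(\<lambda>z. z) nicely_meromorphic_on upper_half_plane"
    by (intro analytic_on_imp_nicely_meromorphic_on analytic_intros)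
  moreover have "\<not> is_pole (\<lambda>z. z) z" for z :: complex
    by (rule analytic_at_imp_no_pole) (intro analytic_intros)
  ultimately have "(\<lambda>z\<in>upper_half_plane. Some z) \<in> meromorphic_maps"
    unfolding meromorphic_maps_def by (auto intro!: exI[of _ "\<lambda>z. z"])
  moreover have "(\<lambda>z\<in>upper_half_plane. Some z) (the (moebius_PSL2R \<gamma> (Some z)))
      = moebius_PSL2R \<gamma> ((\<lambda>z\<in>upper_half_plane. Some z) z)"
    if "\<gamma> \<in> \<Gamma>" "z \<in> upper_half_plane" for \<gamma> z
  proof -
    have "moebius_PSL2R \<gamma> (Some z) \<in> Some ` upper_half_plane"
      using moebius_PSL2R_upper_half_plane that assms by blast
    then show ?thesis using that(2) by auto
  qed
  ultimately show ?thesis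
    by (auto simp: equivariant_functions_def)
qed

theorem theorem4p2:
  fixes \<Gamma> :: "(real^2^2) set set"
  assumes "subgroup \<Gamma> PSL2R"
    and "\<not> discrete_PSL2R \<Gamma>"
    and "\<not> elementary \<Gamma>"
  shows "equivariant_functions \<Gamma> = {\<lambda>z\<in>upper_half_plane. Some z}"
proof
  show "{\<lambda>z\<in>upper_half_plane. Some z} \<subseteq> equivariant_functions \<Gamma>"
    using identity_equivariant[OF subgroup.subset[OF assms(1)]] by blast
next
  show "equivariant_functions \<Gamma> \<subseteq> {\<lambda>z\<in>upper_half_plane. Some z}"
  proof
    fix h assume "h \<in> equivariant_functions \<Gamma>"
    then obtain f where f: "f nicely_meromorphic_on upper_half_plane"
      and h: "h = (\<lambda>z\<in>upper_half_plane. if is_pole f z then None else Some (f z))"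
      and equi: "\<And>\<gamma> z. \<gamma> \<in> \<Gamma> \<Longrightarrow> z \<in> upper_half_plane \<Longrightarrow>
        h (the (moebius_PSL2R \<gamma> (Some z))) = moebius_PSL2R \<gamma> (h z)"
      unfolding equivariant_functions_def meromorphic_maps_def by blast
    have regular: "f z = z" if "z \<in> upper_half_plane" "\<not> is_pole f z" for z
      by (rule regular_point_fixed[OF assms equivariant_at_regular_point[OF assms(1) f h equi that]])
    \<comment> \<open>Poles are isolated, so around a pole \<open>f\<close> would agree with the
      identity and stay bounded.\<close>
    have "\<not> is_pole f z" if z: "z \<in> upper_half_plane" for z
    proof
      assume pole: "is_pole f z"
      have "isolated_singularity_at f z"
        using f z by (auto simp: nicely_meromorphic_on_def intro: meromorphic_on_isolated_singularity meromorphic_on_subset)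
      then have "\<forall>\<^sub>F u in at z. \<not> is_pole f u"
        by (rule eventually_not_pole)
      moreover have "\<forall>\<^sub>F u in at z. u \<in> upper_half_plane"
        using z unfolding upper_half_plane_def
        by (intro eventually_at_in_open' open_halfspace_Im_gt)
      ultimately have "\<forall>\<^sub>F u in at z. f u = u"
        by eventually_elim (auto simp: regular)
      then have "f \<midarrow>z\<rightarrow> z"
        by (simp add: tendsto_cong)
      then show False
        using pole not_tendsto_and_filterlim_at_infinity[of "at z" f z] by (simp add: is_pole_def)
    qed
    then show "h \<in> {\<lambda>z\<in>upper_half_plane. Some z}"
      by (auto simp: h regular restrict_def fun_eq_iff)
  qed
qed

end
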